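(* Let $A$ be an endomorphism of a finite dimensional vector space $V$ over a field $\mathbb{F}$. Assume that the minimal polynomial of $A$ is $m_A=p^r$ with $r\ge 1$ and $p\in\mathbb{F}[x]$ irreducible and separable. If $\operatorname{Chinv}_{\mathbb{F}}(A)\setminus\operatorname{Hinv}_{\mathbb{F}}(A)\neq\emptyset$, then $\deg(p)=1$ and $\mathbb{F}=GF(2)$.
   Context: A polynomial is separable if it is coprime with its derivative. $GF(2)$ is the field with two elements. A subspace $Y\subseteq V$ is hyperinvariant with respect to $A$ if $BY\subseteq Y$ for every $\mathbb{F}$-linear endomorphism $B$ of $V$ with $AB=BA$. A subspace $Y\subseteq V$ is characteristic with respect to $A$ if $AY\subseteq Y$ and $BY\subseteq Y$ for every $\mathbb{F}$-linear automorphism $B$ of $V$ with $AB=BA$. $\operatorname{Hinv}_{\mathbb{F}}(A)$ and $\operatorname{Chinv}_{\mathbb{F}}(A)$ denote the lattices of hyperinvariant and of characteristic subspaces, respectively. *)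

theory Defs
  imports Complex_Main "HOL-Computational_Algebra.Polynomial"
begin

definition separable :: "'f::field poly \<Rightarrow> bool" where
  "separable p \<longleftrightarrow> coprime p (pderiv p)"

definition endomorphism ::
    "('f::field \<Rightarrow> 'v::ab_group_add \<Rightarrow> 'v) \<Rightarrow> ('v \<Rightarrow> 'v) \<Rightarrow> bool" where
  "endomorphism scale A \<longleftrightarrow> Vector_Spaces.linear scale scale A"

definition automorphism ::
    "('f::field \<Rightarrow> 'v::ab_group_add \<Rightarrow> 'v) \<Rightarrow> ('v \<Rightarrow> 'v) \<Rightarrow> bool" where
  "automorphism scale A \<longleftrightarrow> endomorphism scale A \<and> bij A"

(* the operator p(A), applied to a vector v *)
definition poly_op ::
    "('f::field \<Rightarrow> 'v::ab_group_add \<Rightarrow> 'v) \<Rightarrow> 'f poly \<Rightarrow> ('v \<Rightarrow> 'v) \<Rightarrow> 'v \<Rightarrow> 'v" where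
  "poly_op scale p A v = (\<Sum>i\<le>degree p. scale (coeff p i) ((A ^^ i) v))"

(* A relation rather than a function: "m is the minimal polynomial of A". For an
   endomorphism A it determines m uniquely, as the monic polynomial of least degree
   among the nonzero polynomials that annihilate A. *)
definition is_minimal_poly ::
    "('f::field \<Rightarrow> 'v::ab_group_add \<Rightarrow> 'v) \<Rightarrow> ('v \<Rightarrow> 'v) \<Rightarrow> 'f poly \<Rightarrow> bool" where
  "is_minimal_poly scale A m \<longleftrightarrow>
     lead_coeff m = 1 \<and> (\<forall>v. poly_op scale m A v = 0) \<and>
     (\<forall>q. q \<noteq> 0 \<and> (\<forall>v. poly_op scale q A v = 0) \<longrightarrow> degree m \<le> degree q)"

definition Hinv ::
    "('f::field \<Rightarrow> 'v::ab_group_add \<Rightarrow> 'v) \<Rightarrow> ('v \<Rightarrow> 'v) \<Rightarrow> 'v set set" where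
  "Hinv scale A = {Y. module.subspace scale Y \<and>
     (\<forall>B. endomorphism scale B \<and> A \<circ> B = B \<circ> A \<longrightarrow> B ` Y \<subseteq> Y)}"

definition Chinv ::
    "('f::field \<Rightarrow> 'v::ab_group_add \<Rightarrow> 'v) \<Rightarrow> ('v \<Rightarrow> 'v) \<Rightarrow> 'v set set" where
  "Chinv scale A = {Y. module.subspace scale Y \<and> A ` Y \<subseteq> Y \<and>
     (\<forall>B. automorphism scale B \<and> A \<circ> B = B \<circ> A \<longrightarrow> B ` Y \<subseteq> Y)}"

end

theory Submission
  imports Defs
begin

text \<open>
  The residue field \<open>K = F[x]/(p)\<close> has two elements exactly when \<open>deg p = 1\<close> and \<open>F = GF(2)\<close>. The
  claim is therefore that every characteristic
  subspace is hyperinvariant once \<open>K\<close> has an element \<open>c\<close> different from \<open>0\<close> and \<open>1\<close>, and for this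
  it is enough to write each endomorphism \<open>B\<close> commuting with \<open>A\<close> as a sum of two automorphisms
  commuting with \<open>A\<close>: a subspace preserved by both summands is preserved by \<open>B\<close>.

  The element \<open>c\<close> is realised by an operator \<open>C\<close> on \<open>V\<close> such that \<open>C\<close> and \<open>1 - C\<close> are both
  injective and \<open>C\<close> commutes with everything that commutes with \<open>A\<close>. If \<open>F\<close> has a scalar other than
  \<open>0\<close> and \<open>1\<close>, that scalar serves. If \<open>deg p \<noteq> 1\<close>, then \<open>p\<close> has no roots, so \<open>A\<close> has no
  eigenvalues in \<open>F\<close>, and \<open>C = A\<close> serves.

  By Fitting's lemma \<open>V\<close> is the direct sum of a part on which \<open>B\<close> is nilpotent and a part on which
  \<open>B\<close> is injective, and the projection \<open>E\<close> onto the first part along the second commutes with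
  everything that commutes with \<open>B\<close>. On the nilpotent part \<open>B = (B - 1) + 1\<close>, and on the other part
  \<open>B = (1 - C) B + C B\<close>; in both cases the two summands are injective. Gluing them along \<open>E\<close> gives
  the two automorphisms.
\<close>

section \<open>Endomorphisms of a vector space\<close>

context vector_space
begin

lemma endomorphism_iff:
  "endomorphism scale f \<longleftrightarrow>
     (\<forall>x y. f (x + y) = f x + f y) \<and> (\<forall>c x. f (scale c x) = scale c (f x))"
  unfolding endomorphism_def Vector_Spaces.linear_iff using vector_space_axioms by auto

lemma endomorphism_add:
  "endomorphism scale f \<Longrightarrow> f (x + y) = f x + f y"
  by (simp add: endomorphism_iff)

lemma endomorphism_scale:
  "endomorphism scale f \<Longrightarrow> f (scale c x) = scale c (f x)"
  by (simp add: endomorphism_iff)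

lemma endomorphism_zero:
  "endomorphism scale f \<Longrightarrow> f 0 = 0"
  using endomorphism_scale[of f 0 0] by simp

lemma endomorphism_diff:
  assumes "endomorphism scale f"
  shows "f (x - y) = f x - f y"
  using endomorphism_add[OF assms, of "x - y" y] by simp

lemma endomorphism_funpow:
  assumes "endomorphism scale f"
  shows "endomorphism scale (f ^^ n)"
  by (induction n) (use assms in \<open>auto simp: endomorphism_iff\<close>)

lemma endomorphism_injI:
  assumes f: "endomorphism scale f" and ker: "\<And>v. f v = 0 \<Longrightarrow> v = 0"
  shows "inj f"
proof (rule injI)
  fix x y assume "f x = f y"
  then have "f (x - y) = 0" by (simp add: endomorphism_diff[OF f])
  then show "x = y" using ker by fastforce
qed

text \<open>
  An eigenvalue of \<open>A\<close> is thus a root of every polynomial annihilating \<open>A\<close>.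
\<close>

lemma poly_op_eigenvector:
  assumes A: "endomorphism scale A" and v: "A v = scale a v"
  shows "poly_op scale q A v = scale (poly q a) v"
proof -
  have "(A ^^ i) v = scale (a ^ i) v" for i
    by (induction i) (simp_all add: endomorphism_scale[OF A] v mult.commute)
  then show ?thesis
    by (simp add: poly_op_def poly_altdef scale_sum_left)
qed

end

lemma funpow_commute:
  assumes "\<And>v. f (g v) = g (f v)"
  shows "f ((g ^^ n) v) = (g ^^ n) (f v)"
  by (induction n) (simp_all add: assms)

section \<open>The Fitting decomposition\<close>

context finite_dimensional_vector_space
begin

lemma automorphismI:
  assumes f: "endomorphism scale f" and ker: "\<And>v. f v = 0 \<Longrightarrow> v = 0"
  shows "automorphism scale f"
proof -
  have "inj f" by (rule endomorphism_injI[OF f ker])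
  moreover have "surj f"
    using linear_inj_imp_surj[OF f[unfolded endomorphism_def] \<open>inj f\<close>] .
  ultimately show ?thesis
    using f by (simp add: automorphism_def bij_def)
qed

text \<open>The kernels of the powers increase, and their dimensions are bounded.\<close>

lemma kernel_funpow_stable:
  assumes B: "endomorphism scale B"
  obtains n where "\<And>k v. (B ^^ (k + n)) v = 0 \<longleftrightarrow> (B ^^ n) v = 0"
proof -
  define N where "N n = {v. (B ^^ n) v = 0}" for n
  have sub: "subspace (N n)" for n
    using endomorphism_funpow[OF B, of n]
    by (auto simp: N_def subspace_def endomorphism_add endomorphism_scale endomorphism_zero)
  obtain n where n: "\<And>m. dim (N m) \<le> dim (N n)"
    using ex_has_greatest_nat[of "\<lambda>_. True" _ "\<lambda>m. dim (N m)" "Suc dimension"]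
      dim_subset_UNIV by (auto simp: less_Suc_eq_le)
  have "N n = N (k + n)" for k
  proof (rule subspace_dim_equal[OF sub sub _ n])
    show "N n \<subseteq> N (k + n)"
      using endomorphism_zero[OF endomorphism_funpow[OF B]]
      by (auto simp: N_def funpow_add)
  qed
  then have "(B ^^ (k + n)) v = 0 \<longleftrightarrow> (B ^^ n) v = 0" for k v
    unfolding N_def by blast
  then show ?thesis by (rule that)
qed

text \<open>
  Fitting's lemma, in the form of a projection: once the kernels of the powers of \<open>B\<close> are stable
  from \<open>n\<close> on, \<open>V\<close> is the direct sum of the kernel and the range of \<open>B ^^ n\<close>. Every operator
  commuting with \<open>B\<close> preserves both summands, hence commutes with the projection.
\<close>

lemma Fitting_projection:
  assumes B: "endomorphism scale B"
  obtains E n where "endomorphism scale E"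
    and "\<And>v. E (E v) = E v"
    and "\<And>v. (B ^^ n) (E v) = 0"
    and "\<And>v. E v = 0 \<Longrightarrow> B v = 0 \<Longrightarrow> v = 0"
    and "\<And>S v. endomorphism scale S \<Longrightarrow> (\<And>w. S (B w) = B (S w)) \<Longrightarrow> S (E v) = E (S v)"
proof -
  obtain n where stable: "\<And>k v. (B ^^ (k + n)) v = 0 \<longleftrightarrow> (B ^^ n) v = 0"
    using kernel_funpow_stable[OF B] by blast
  define G where "G = B ^^ n"
  have G: "endomorphism scale G"
    unfolding G_def by (rule endomorphism_funpow[OF B])
  have GG: "G v = 0" if "G (G v) = 0" for v
    using that stable[of n v] by (simp add: G_def funpow_add)
  interpret pair: finite_dimensional_vector_space_pair_1 scale Basis scale
    by unfold_locales
  have subW: "subspace (range G)"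
    by (rule pair.linear_subspace_image[OF G[unfolded endomorphism_def] subspace_UNIV])
  \<comment> \<open>Injective on its own range, \<open>G\<close> also maps that range onto itself, for reasons of dimension.\<close>
  have inj: "inj_on G (range G)"
  proof (rule inj_onI)
    fix x y assume "x \<in> range G" "y \<in> range G" and eq: "G x = G y"
    then obtain a where a: "x - y = G a"
      by (auto simp: endomorphism_diff[OF G, symmetric])
    have "G (G a) = 0" unfolding a[symmetric] by (simp add: endomorphism_diff[OF G] eq)
    then have "x - y = 0" unfolding a by (rule GG)
    then show "x = y" by simp
  qed
  have onto: "G ` range G = range G"
  proof (rule subspace_dim_equal)
    show "subspace (G ` range G)"
      using subW by (rule pair.linear_subspace_image[OF G[unfolded endomorphism_def]])
    show "dim (range G) \<le> dim (G ` range G)"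
      using pair.dim_image_eq[OF G[unfolded endomorphism_def], of "range G"] inj subW
      by (simp add: span_eq_iff[THEN iffD2])
  qed (use subW in auto)
  have "\<exists>k. G k = 0 \<and> v - k \<in> range G" for v
  proof -
    obtain w where "G v = G (G w)" using onto by blast
    then show ?thesis
      by (intro exI[of _ "v - G w"]) (simp add: endomorphism_diff[OF G])
  qed
  then obtain E where E0: "\<And>v. G (E v) = 0" and E1: "\<And>v. v - E v \<in> range G"
    by metis
  have E_eq: "E v = k" if "G k = 0" "v - k \<in> range G" for v k
  proof -
    have "(v - k) - (v - E v) \<in> range G"
      using subspace_diff[OF subW that(2) E1] .
    then obtain a where a: "E v - k = G a" by auto
    have "G (G a) = 0"
      unfolding a[symmetric] by (simp add: endomorphism_diff[OF G] E0 that)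
    then have "E v - k = 0" unfolding a by (rule GG)
    then show ?thesis by simp
  qed
  have "E (x + y) = E x + E y" for x y
  proof (rule E_eq)
    show "x + y - (E x + E y) \<in> range G"
      using subspace_add[OF subW E1[of x] E1[of y]] by (simp add: algebra_simps)
  qed (simp add: endomorphism_add[OF G] E0)
  moreover have "E (scale c x) = scale c (E x)" for c x
  proof (rule E_eq)
    show "scale c x - scale c (E x) \<in> range G"
      using subspace_scale[OF subW E1[of x], of c] by (simp add: scale_right_diff_distrib)
  qed (simp add: endomorphism_scale[OF G] E0)
  ultimately have endE: "endomorphism scale E" by (simp add: endomorphism_iff)
  show ?thesis
  proof (rule that[of E n, OF endE])
    show "E (E v) = E v" for v
      by (rule E_eq) (simp_all add: E0 subspace_0[OF subW])
    show "(B ^^ n) (E v) = 0" for v using E0 by (simp add: G_def)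
    show "v = 0" if "E v = 0" "B v = 0" for v
    proof -
      have "G v = 0"
        using stable[of 1 v] that(2) endomorphism_zero[OF endomorphism_funpow[OF B]]
        by (simp add: G_def funpow_swap1)
      then have "E v = v" by (rule E_eq) (simp add: subspace_0[OF subW])
      with that(1) show ?thesis by simp
    qed
    show "S (E v) = E (S v)"
      if S: "endomorphism scale S" and c: "\<And>w. S (B w) = B (S w)" for S v
    proof (rule E_eq[symmetric])
      have SG: "S (G w) = G (S w)" for w
        unfolding G_def using c by (rule funpow_commute)
      show "G (S (E v)) = 0"
        using SG[of "E v"] by (simp add: E0 endomorphism_zero[OF S])
      obtain w where "v - E v = G w" using E1[of v] by auto
      then have "S v - S (E v) = G (S w)"
        using SG endomorphism_diff[OF S] by metis
      then show "S v - S (E v) \<in> range G" by auto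
    qed
  qed
qed

section \<open>Endomorphisms as sums of two automorphisms\<close>

text \<open>
  Two operators that respect the decomposition given by an idempotent can be glued, and
  injectivity need only be checked on the respective summand.
\<close>

lemma automorphism_glue:
  assumes E: "endomorphism scale E" and idem: "\<And>v. E (E v) = E v"
    and S: "endomorphism scale S" and SE: "\<And>v. S (E v) = E (S v)"
    and T: "endomorphism scale T" and TE: "\<And>v. T (E v) = E (T v)"
    and kerS: "\<And>v. E v = v \<Longrightarrow> S v = 0 \<Longrightarrow> v = 0"
    and kerT: "\<And>v. E v = 0 \<Longrightarrow> T v = 0 \<Longrightarrow> v = 0"
  shows "automorphism scale (\<lambda>v. S (E v) + T (v - E v))"
proof (rule automorphismI)
  show "endomorphism scale (\<lambda>v. S (E v) + T (v - E v))"
    unfolding endomorphism_iff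
  proof (intro conjI allI)
    show "S (E (x + y)) + T (x + y - E (x + y))
        = S (E x) + T (x - E x) + (S (E y) + T (y - E y))" for x y
      by (simp add: E S T endomorphism_add endomorphism_diff)
    show "S (E (scale c x)) + T (scale c x - E (scale c x))
        = scale c (S (E x) + T (x - E x))" for c x
      by (simp add: E S T endomorphism_scale endomorphism_diff scale_right_distrib
          scale_right_diff_distrib)
  qed
next
  fix v assume 0: "S (E v) + T (v - E v) = 0"
  have "E (T (v - E v)) = 0"
    by (simp add: TE[symmetric] endomorphism_diff[OF E] idem endomorphism_zero[OF T])
  moreover have "E (S (E v)) = S (E v)"
    by (simp add: SE[symmetric] idem)
  ultimately have SEv: "S (E v) = 0"
    using arg_cong[OF 0, of E] by (simp add: endomorphism_add[OF E] endomorphism_zero[OF E])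
  then have "E v = 0" using kerS idem by blast
  moreover have "T v = 0"
    using 0 SEv \<open>E v = 0\<close> by simp
  ultimately show "v = 0" by (rule kerT)
qed

text \<open>
  The splitting \<open>B = (B - 1) + 1\<close> where \<open>B\<close> is nilpotent and \<open>B = (1 - C) B + C B\<close> where \<open>B\<close> is
  injective.
\<close>

lemma sum_of_two_automorphisms:
  assumes B: "endomorphism scale B"
    and C: "endomorphism scale C" and CB: "\<And>v. C (B v) = B (C v)"
    and ker0: "\<And>v. C v = 0 \<Longrightarrow> v = 0" and ker1: "\<And>v. C v = v \<Longrightarrow> v = 0"
    and A: "endomorphism scale A" and AB: "\<And>v. A (B v) = B (A v)"
    and AC: "\<And>v. A (C v) = C (A v)"
  obtains U1 U2 where "automorphism scale U1" "\<And>v. A (U1 v) = U1 (A v)"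
    and "automorphism scale U2" "\<And>v. A (U2 v) = U2 (A v)"
    and "\<And>v. B v = U1 v + U2 v"
proof (rule Fitting_projection[OF B])
  fix E n
  assume E: "endomorphism scale E" and idem: "\<And>v. E (E v) = E v"
    and nilp: "\<And>v. (B ^^ n) (E v) = 0" and kerB: "\<And>v. E v = 0 \<Longrightarrow> B v = 0 \<Longrightarrow> v = 0"
    and comm: "\<And>S v. endomorphism scale S \<Longrightarrow> (\<And>w. S (B w) = B (S w)) \<Longrightarrow> S (E v) = E (S v)"
  note EA = comm[of A, OF A AB] and EB = comm[of B, OF B refl] and EC = comm[of C, OF C CB]
  define U1 where "U1 v = (B (E v) - E v) + (B (v - E v) - C (B (v - E v)))" for v
  define U2 where "U2 v = E v + C (B (v - E v))" for v
  have "automorphism scale (\<lambda>v. (\<lambda>v. B v - v) (E v) + (\<lambda>v. B v - C (B v)) (v - E v))"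
  proof (rule automorphism_glue[OF E idem])
    fix v assume "E v = v" "B v - v = 0"
    then have "(B ^^ n) v = v" by (induction n) auto
    with nilp[of v] \<open>E v = v\<close> show "v = 0" by simp
  next
    fix v assume "E v = 0" "B v - C (B v) = 0"
    from \<open>B v - C (B v) = 0\<close> have "B v = 0" by (intro ker1) simp
    with \<open>E v = 0\<close> show "v = 0" by (rule kerB)
  qed (use B C in \<open>simp_all add: endomorphism_iff scale_right_diff_distrib
        endomorphism_diff[OF E] EB EC\<close>)
  then have U1: "automorphism scale U1" by (simp add: U1_def[abs_def])
  have "automorphism scale (\<lambda>v. (\<lambda>v. v) (E v) + (\<lambda>v. C (B v)) (v - E v))"
  proof (rule automorphism_glue[OF E idem])
    fix v assume "E v = 0" and "C (B v) = 0"
    from \<open>C (B v) = 0\<close> have "B v = 0" by (rule ker0)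
    with \<open>E v = 0\<close> show "v = 0" by (rule kerB)
  qed (use B C in \<open>simp_all add: endomorphism_iff EB EC\<close>)
  then have U2: "automorphism scale U2" by (simp add: U2_def[abs_def])
  show ?thesis
  proof (rule that[OF U1 _ U2])
    show "A (U1 v) = U1 (A v)" for v
      by (simp add: U1_def endomorphism_add[OF A] endomorphism_diff[OF A] EA AB AC)
    show "A (U2 v) = U2 (A v)" for v
      by (simp add: U2_def endomorphism_add[OF A] endomorphism_diff[OF A] EA AB AC)
    show "B v = U1 v + U2 v" for v
      by (simp add: U1_def U2_def endomorphism_diff[OF B])
  qed
qed

text \<open>
  Such a \<open>C\<close> must commute with the whole centralizer of \<open>A\<close>, because the splitting above is applied
  to every \<open>B\<close> in it with the same \<open>C\<close>; since \<open>A\<close> itself belongs to the centralizer, \<open>C\<close> commutes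
  with \<open>A\<close> and the two automorphisms do as well.
\<close>

lemma Chinv_subset_Hinv:
  assumes A: "endomorphism scale A" and C: "endomorphism scale C"
    and central: "\<And>B v. endomorphism scale B \<Longrightarrow> (\<And>w. A (B w) = B (A w)) \<Longrightarrow> C (B v) = B (C v)"
    and ker0: "\<And>v. C v = 0 \<Longrightarrow> v = 0" and ker1: "\<And>v. C v = v \<Longrightarrow> v = 0"
  shows "Chinv scale A \<subseteq> Hinv scale A"
proof
  fix Y assume "Y \<in> Chinv scale A"
  then have Y: "subspace Y"
    and inv: "\<And>U. automorphism scale U \<Longrightarrow> A \<circ> U = U \<circ> A \<Longrightarrow> U ` Y \<subseteq> Y"
    by (auto simp: Chinv_def)
  have "B y \<in> Y" if B: "endomorphism scale B" and "A \<circ> B = B \<circ> A" and y: "y \<in> Y" for B y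
  proof -
    have AB: "A (B v) = B (A v)" for v
      using fun_cong[OF \<open>A \<circ> B = B \<circ> A\<close>, of v] by simp
    have CB: "C (B v) = B (C v)" for v by (rule central[of B, OF B AB])
    have AC: "A (C v) = C (A v)" for v by (rule central[of A, OF A refl, symmetric])
    show ?thesis
    proof (rule sum_of_two_automorphisms[where A = A and B = B and C = C,
          OF B C CB ker0 ker1 A AB AC])
      fix U1 U2
      assume "automorphism scale U1" "\<And>v. A (U1 v) = U1 (A v)"
        and "automorphism scale U2" "\<And>v. A (U2 v) = U2 (A v)"
        and sum: "\<And>v. B v = U1 v + U2 v"
      then have "U1 ` Y \<subseteq> Y" "U2 ` Y \<subseteq> Y"
        by (simp_all add: inv fun_eq_iff)
      then have "U1 y \<in> Y" "U2 y \<in> Y" using y by auto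
      then show "B y \<in> Y" unfolding sum by (rule subspace_add[OF Y])
    qed
  qed
  with Y show "Y \<in> Hinv scale A" by (auto simp: Hinv_def)
qed

end

section \<open>Operators whose minimal polynomial is a prime power\<close>

lemma irreducible_root_imp_degree_1:
  fixes p :: "'f::field poly"
  assumes p: "irreducible p" and root: "poly p a = 0"
  shows "degree p = 1"
proof -
  have dvd: "[:- a, 1:] dvd p" using root by (simp add: poly_eq_0_iff_dvd)
  have "\<not> is_unit [:- a, 1:]" by (simp add: is_unit_iff_degree)
  then have "p dvd [:- a, 1:]" using irreducibleD'[OF p dvd] by blast
  then have "degree p \<le> 1" using dvd_imp_degree_le[of p "[:- a, 1:]"] by simp
  moreover have "1 \<le> degree p"
    using dvd_imp_degree_le[OF dvd] p by (cases "p = 0") simp_all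
  ultimately show ?thesis by simp
qed

theorem theorem3p4:
  fixes scale :: "'f::field \<Rightarrow> 'v::ab_group_add \<Rightarrow> 'v"
    and Basis :: "'v set"
    and A :: "'v \<Rightarrow> 'v"
    and p :: "'f poly"
    and r :: nat
  assumes "finite_dimensional_vector_space scale Basis"
    and "endomorphism scale A"
    and "r \<ge> 1"
    and "irreducible p"
    and "separable p"
    and "is_minimal_poly scale A (p ^ r)"
    and "Chinv scale A - Hinv scale A \<noteq> {}"
  shows "degree p = 1 \<and> card (UNIV :: 'f set) = 2"
proof -
  interpret finite_dimensional_vector_space scale Basis by fact
  note A = \<open>endomorphism scale A\<close>
  have not_sub: "\<not> Chinv scale A \<subseteq> Hinv scale A" using assms(7) by blast
  have "degree p = 1"
  proof (rule ccontr)
    assume deg: "degree p \<noteq> 1"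
    \<comment> \<open>Without eigenvalues \<open>0\<close> and \<open>1\<close>, both \<open>A\<close> and \<open>1 - A\<close> are injective.\<close>
    have no_eigenvector: "v = 0" if v: "A v = scale a v" for a v
    proof -
      have "scale (poly (p ^ r) a) v = 0"
        using poly_op_eigenvector[OF A v, of "p ^ r"] assms(6) by (simp add: is_minimal_poly_def)
      moreover have "poly p a \<noteq> 0"
        using irreducible_root_imp_degree_1[OF \<open>irreducible p\<close>] deg by blast
      ultimately show ?thesis by simp
    qed
    have "Chinv scale A \<subseteq> Hinv scale A"
      by (rule Chinv_subset_Hinv[OF A A])
        (use no_eigenvector[of _ 0] no_eigenvector[of _ 1] in simp_all)
    with not_sub show False by simp
  qed
  moreover have "card (UNIV :: 'f set) = 2"
  proof (rule ccontr)
    assume "card (UNIV :: 'f set) \<noteq> 2"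
    then have "UNIV \<noteq> {0 :: 'f, 1}"
      by (metis card_2_iff zero_neq_one)
    then obtain c :: 'f where c: "c \<noteq> 0" "c \<noteq> 1" by auto
    have "Chinv scale A \<subseteq> Hinv scale A"
    proof (rule Chinv_subset_Hinv[OF A, of "scale c"])
      show "endomorphism scale (scale c)"
        by (simp add: endomorphism_iff scale_right_distrib mult.commute)
      show "v = 0" if "scale c v = v" for v
      proof -
        have "scale (c - 1) v = 0" using that by (simp add: scale_left_diff_distrib)
        with c show ?thesis by simp
      qed
    qed (use c in \<open>simp_all add: endomorphism_scale\<close>)
    with not_sub show False by simp
  qed
  ultimately show ?thesis ..
qed

end
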